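(* Assume $K(x,y)>0$, $\mu(x)>0$, $\nu(y)>0$ for all $x,y\in S$. Let $g_t$, $t\ge0$, be the solution of $$\dot g_t=-\log\frac{m_{g_t}}{\nu}+\mathbb E_\nu\!\left[\log\frac{m_{g_t}}{\nu}\right]\mathbf 1$$ with initial condition $g_0\in\mathcal H$, and set $m_t=m_{g_t}$. Then, for all $t\ge0$, $$\dot m_t=-\mathsf K_{g_t}\log\frac{m_t}{\nu}=-\mathsf K_{g_t}\,\frac{\delta}{\delta m}\operatorname{KL}(m_t\|\nu),$$ where $\frac{\delta}{\delta m}\operatorname{KL}(m\|\nu)=\log\frac{m}{\nu}+\mathbf 1$.
   Context: Let $N\ge1$ be an integer and $S=\{1,\dots,N\}$. Let $Q\in\mathbb R^{N\times N}$ be the generator of a continuous-time Markov chain on $S$ (nonnegative off-diagonal entries, rows summing to zero) and $K=e^{Q}$. Let $\mu,\nu$ be probability distributions on $S$. Functions on $S$ are identified with vectors in $\mathbb R^S$; $\mathbf 1$ is the constant function $1$; $\mathbb E_\nu[f]=\sum_{y\in S}\nu(y)f(y)$; $\log\frac{m}{\nu}$ is the function $y\mapsto\log(m(y)/\nu(y))$; $\operatorname{KL}(m\|\nu)=\sum_y m(y)\log\frac{m(y)}{\nu(y)}$, and $\frac{\delta}{\delta m}\operatorname{KL}(m\|\nu)$ is its vector of partial derivatives with respect to the coordinates $m(y)$. For $g\in\mathbb R^S$ set $Z_g(x)=\sum_{z\in S}K(x,z)e^{g(z)}$, $p_g(y|x)=\frac{K(x,y)e^{g(y)}}{Z_g(x)}$,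 $m_g(y)=\sum_{x\in S}\mu(x)p_g(y|x)$ (strictly positive). The gauge-fixed space is $\mathcal H=\{g\in\mathbb R^S:\mathbb E_\nu[g]=0\}$. For every $g_0\in\mathcal H$ the ODE $\dot g_t=-\log\frac{m_{g_t}}{\nu}+\mathbb E_\nu\!\left[\log\frac{m_{g_t}}{\nu}\right]\mathbf 1$ with initial condition $g_{t=0}=g_0$ has a unique global solution, which stays in $\mathcal H$. The operator $\mathsf K_g:\mathbb R^S\to\mathbb R^S$ is $$\mathsf K_g=Dm_g=\sum_{x\in S}\mu(x)\left[\operatorname{Diag}(p_g(\cdot|x))-p_g(\cdot|x)p_g(\cdot|x)^\top\right].$$ *)

theory Defs
  imports "HOL-Analysis.Analysis"
begin

section \<open>Markov generators and the matrix exponential\<close>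

definition is_generator :: "real ^ 's ^ 's::finite \<Rightarrow> bool" where
  "is_generator Q \<longleftrightarrow>
     (\<forall>x y. x \<noteq> y \<longrightarrow> Q $ x $ y \<ge> 0) \<and> (\<forall>x. (\<Sum>y\<in>UNIV. Q $ x $ y) = 0)"

definition is_prob_vec :: "real ^ 's::finite \<Rightarrow> bool" where
  "is_prob_vec p \<longleftrightarrow> (\<forall>x. p $ x \<ge> 0) \<and> (\<Sum>x\<in>UNIV. p $ x) = 1"

definition matpow :: "real ^ 's ^ 's::finite \<Rightarrow> nat \<Rightarrow> real ^ 's ^ 's" where
  "matpow A k = ((\<lambda>B. A ** B) ^^ k) (mat 1)"

definition matexp :: "real ^ 's ^ 's::finite \<Rightarrow> real ^ 's ^ 's" where
  "matexp A = (\<Sum>k. (1 / fact k) *\<^sub>R matpow A k)"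

lemma matpow_entry_bound:
  fixes A :: "real ^ 's ^ 's::finite"
  assumes B: "\<And>i j. \<bar>A $ i $ j\<bar> \<le> B"
  shows "\<bar>matpow A k $ i $ j\<bar> \<le> (real CARD('s) * B) ^ k"
proof (induction k arbitrary: i j)
  case 0
  show ?case by (simp add: matpow_def mat_def)
next
  case (Suc k)
  have B0: "0 \<le> B" using B[of i j] by linarith
  have "\<bar>matpow A (Suc k) $ i $ j\<bar> = \<bar>\<Sum>l\<in>UNIV. A $ i $ l * matpow A k $ l $ j\<bar>"
    by (simp add: matpow_def matrix_matrix_mult_def)
  also have "\<dots> \<le> (\<Sum>l\<in>UNIV. \<bar>A $ i $ l * matpow A k $ l $ j\<bar>)"
    by (rule sum_abs)
  also have "\<dots> \<le> (\<Sum>l\<in>(UNIV::'s set). B * (real CARD('s) * B) ^ k)"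
    by (rule sum_mono) (auto simp: abs_mult intro!: mult_mono B Suc B0)
  also have "\<dots> = (real CARD('s) * B) ^ Suc k" by simp
  finally show ?case .
qed

lemma summable_matexp: "summable (\<lambda>k. (1 / fact k) *\<^sub>R matpow A k)"
  for A :: "real ^ 's ^ 's::finite"
proof -
  define B where "B = (\<Sum>i\<in>UNIV. \<Sum>j\<in>UNIV. \<bar>A $ i $ j\<bar>)"
  have B: "\<bar>A $ i $ j\<bar> \<le> B" for i j
  proof -
    have "\<bar>A $ i $ j\<bar> \<le> (\<Sum>j\<in>UNIV. \<bar>A $ i $ j\<bar>)"
      by (rule member_le_sum) auto
    also have "\<dots> \<le> B" unfolding B_def
      by (rule member_le_sum[where f = "\<lambda>i. \<Sum>j\<in>UNIV. \<bar>A $ i $ j\<bar>"])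
         (auto intro: sum_nonneg)
    finally show ?thesis .
  qed
  let ?c = "real CARD('s)"
  have nb: "norm (matpow A k) \<le> ?c * (?c * (?c * B) ^ k)" for k
  proof -
    have "norm (matpow A k) \<le> (\<Sum>i\<in>UNIV. norm (matpow A k $ i))"
      unfolding norm_vec_def by (rule L2_set_le_sum) auto
    also have "\<dots> \<le> (\<Sum>i\<in>UNIV. \<Sum>j\<in>UNIV. \<bar>matpow A k $ i $ j\<bar>)"
      by (intro sum_mono norm_le_l1_cart)
    also have "\<dots> \<le> (\<Sum>i\<in>(UNIV::'s set). \<Sum>j\<in>(UNIV::'s set). (?c * B) ^ k)"
      by (intro sum_mono matpow_entry_bound B)
    finally show ?thesis by simp
  qed
  have "summable (\<lambda>k. ?c * ?c * (inverse (fact k) * (?c * B) ^ k))"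
    by (intro summable_mult summable_exp)
  then show ?thesis
  proof (rule summable_comparison_test'[where N = 0])
    fix k
    have "norm ((1 / fact k) *\<^sub>R matpow A k) = inverse (fact k) * norm (matpow A k)"
      by (simp add: inverse_eq_divide)
    also have "\<dots> \<le> inverse (fact k) * (?c * (?c * (?c * B) ^ k))"
      by (intro mult_left_mono nb) auto
    finally show "norm ((1 / fact k) *\<^sub>R matpow A k)
        \<le> ?c * ?c * (inverse (fact k) * (?c * B) ^ k)"
      by (simp add: mult_ac)
  qed
qed


section \<open>The exponentially tilted kernel and its marginal\<close>

definition Zfun :: "real ^ 's ^ 's::finite \<Rightarrow> real ^ 's \<Rightarrow> 's \<Rightarrow> real" where
  "Zfun K g x = (\<Sum>z\<in>UNIV. K $ x $ z * exp (g $ z))"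

text \<open>\<open>tilted K g x\<close> is the vector \<open>y \<mapsto> p\<^sub>g(y|x)\<close>.\<close>

definition tilted :: "real ^ 's ^ 's::finite \<Rightarrow> real ^ 's \<Rightarrow> 's \<Rightarrow> real ^ 's" where
  "tilted K g x = (\<chi> y. K $ x $ y * exp (g $ y) / Zfun K g x)"

definition marginal :: "real ^ 's ^ 's::finite \<Rightarrow> real ^ 's \<Rightarrow> real ^ 's \<Rightarrow> real ^ 's" where
  "marginal K \<mu> g = (\<Sum>x\<in>UNIV. \<mu> $ x *\<^sub>R tilted K g x)"

definition Diag :: "real ^ 's \<Rightarrow> real ^ 's ^ 's::finite" where
  "Diag v = (\<chi> i j. if i = j then v $ i else 0)"

definition outer :: "real ^ 's \<Rightarrow> real ^ 's \<Rightarrow> real ^ 's ^ 's::finite" where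
  "outer v w = (\<chi> i j. v $ i * w $ j)"

definition Kop :: "real ^ 's ^ 's::finite \<Rightarrow> real ^ 's \<Rightarrow> real ^ 's \<Rightarrow> real ^ 's ^ 's" where
  "Kop K \<mu> g =
     (\<Sum>x\<in>UNIV. \<mu> $ x *\<^sub>R (Diag (tilted K g x) - outer (tilted K g x) (tilted K g x)))"

lemma Zfun_pos:
  assumes "\<And>x y. K $ x $ y > 0"
  shows "Zfun K g x > 0"
  unfolding Zfun_def by (rule sum_pos) (auto simp: assms)

lemma has_derivative_tilted:
  fixes K :: "real ^ 's ^ 's::finite"
  assumes K: "\<And>x y. K $ x $ y > 0"
  shows "((\<lambda>g. tilted K g x) has_derivative
      (\<lambda>v. (Diag (tilted K g x) - outer (tilted K g x) (tilted K g x)) *v v)) (at g)"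
proof (subst has_derivative_componentwise_within, intro ballI)
  fix b :: "real ^ 's" assume "b \<in> Basis"
  then obtain y where b: "b = axis y 1" by (auto simp: Basis_vec_def)
  let ?Z = "Zfun K g x"
  have Z: "?Z \<noteq> 0" using Zfun_pos[OF K, where g = g and x = x] by simp
  have nth: "((\<lambda>g. g $ z) has_derivative (\<lambda>v. v $ z)) (at g)" for z
    by (rule bounded_linear_imp_has_derivative) (rule bounded_linear_vec_nth)
  have dN: "((\<lambda>g. K $ x $ z * exp (g $ z)) has_derivative
      (\<lambda>v. K $ x $ z * (exp (g $ z) * v $ z))) (at g)" for z
    by (rule has_derivative_mult_right, rule has_derivative_eq_rhs,
        rule has_derivative_exp, rule nth) (simp add: mult.commute)
  have dZ: "((\<lambda>g. Zfun K g x) has_derivative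
      (\<lambda>v. \<Sum>z\<in>UNIV. K $ x $ z * (exp (g $ z) * v $ z))) (at g)"
    unfolding Zfun_def by (rule has_derivative_sum) (rule dN)
  let ?S = "\<lambda>v. \<Sum>z\<in>UNIV. K $ x $ z * (exp (g $ z) * v $ z)"
  have d: "((\<lambda>g. K $ x $ y * exp (g $ y) / Zfun K g x) has_derivative
      (\<lambda>v. (K $ x $ y * (exp (g $ y) * v $ y) * ?Z - K $ x $ y * exp (g $ y) * ?S v) / (?Z * ?Z)))
      (at g)"
    by (rule has_derivative_divide'[OF dN dZ Z])
  have e: "((Diag (tilted K g x) - outer (tilted K g x) (tilted K g x)) *v v) $ y =
      (K $ x $ y * (exp (g $ y) * v $ y) * ?Z - K $ x $ y * exp (g $ y) * ?S v) / (?Z * ?Z)" for v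
  proof -
    have "((Diag (tilted K g x) - outer (tilted K g x) (tilted K g x)) *v v) $ y =
      (\<Sum>z\<in>UNIV. (if y = z then tilted K g x $ y * v $ z else 0)
         - tilted K g x $ y * (tilted K g x $ z * v $ z))"
      unfolding matrix_vector_mult_def Diag_def outer_def
      by (auto intro!: sum.cong simp: algebra_simps)
    also have "\<dots> = tilted K g x $ y * v $ y
        - tilted K g x $ y * (\<Sum>z\<in>UNIV. tilted K g x $ z * v $ z)"
      by (simp add: sum_subtractf sum_distrib_left)
    also have "(\<Sum>z\<in>UNIV. tilted K g x $ z * v $ z) = ?S v / ?Z"
      by (simp add: tilted_def sum_divide_distrib mult_ac)
    finally show ?thesis using Z by (simp add: tilted_def field_simps)
  qed
  have "((\<lambda>g. tilted K g x $ y) has_derivative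
      (\<lambda>v. ((Diag (tilted K g x) - outer (tilted K g x) (tilted K g x)) *v v) $ y)) (at g)"
    unfolding e using d by (simp add: tilted_def)
  then show "((\<lambda>g. tilted K g x \<bullet> b) has_derivative
      (\<lambda>v. ((Diag (tilted K g x) - outer (tilted K g x) (tilted K g x)) *v v) \<bullet> b)) (at g)"
    by (simp add: b inner_axis)
qed

text \<open>\<open>Kop\<close> is the Jacobian of the marginal map.\<close>

lemma has_derivative_marginal:
  fixes K :: "real ^ 's ^ 's::finite"
  assumes K: "\<And>x y. K $ x $ y > 0"
  shows "(marginal K \<mu> has_derivative (\<lambda>v. Kop K \<mu> g *v v)) (at g)"
proof -
  have "((\<lambda>g. \<Sum>x\<in>UNIV. \<mu> $ x *\<^sub>R tilted K g x) has_derivative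
     (\<lambda>v. \<Sum>x\<in>UNIV. \<mu> $ x *\<^sub>R
        ((Diag (tilted K g x) - outer (tilted K g x) (tilted K g x)) *v v))) (at g)"
    by (intro has_derivative_sum has_derivative_scaleR_right has_derivative_tilted K)
  moreover have "(\<Sum>x\<in>A. \<mu> $ x *\<^sub>R
        ((Diag (tilted K g x) - outer (tilted K g x) (tilted K g x)) *v v)) =
     (\<Sum>x\<in>A. \<mu> $ x *\<^sub>R (Diag (tilted K g x) - outer (tilted K g x) (tilted K g x))) *v v"
    if "finite A" for A :: "'s set" and v
    using that by (induction A rule: finite_induct)
      (simp_all add: matrix_vector_mult_add_rdistrib scaleR_matrix_vector_assoc)
  ultimately show ?thesis
    by (simp add: marginal_def[abs_def] Kop_def)
qed


section \<open>Relative entropy and the gauge-fixed flow\<close>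

definition Expect :: "real ^ 's::finite \<Rightarrow> real ^ 's \<Rightarrow> real" where
  "Expect \<nu> f = (\<Sum>y\<in>UNIV. \<nu> $ y * f $ y)"

definition log_ratio :: "real ^ 's::finite \<Rightarrow> real ^ 's \<Rightarrow> real ^ 's" where
  "log_ratio m \<nu> = (\<chi> y. ln (m $ y / \<nu> $ y))"

definition KL :: "real ^ 's::finite \<Rightarrow> real ^ 's \<Rightarrow> real" where
  "KL m \<nu> = (\<Sum>y\<in>UNIV. m $ y * ln (m $ y / \<nu> $ y))"

text \<open>\<open>KL\<close> as a function of the single coordinate \<open>m(y)\<close>; it is defined on all of \<open>\<real>\<^sup>S\<close>,
  so the coordinates vary freely and not only within the probability simplex.\<close>

definition KL_coord :: "real ^ 's::finite \<Rightarrow> real ^ 's \<Rightarrow> 's \<Rightarrow> real \<Rightarrow> real" where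
  "KL_coord m \<nu> y s = KL (\<chi> z. if z = y then s else m $ z) \<nu>"

definition KL_var :: "real ^ 's::finite \<Rightarrow> real ^ 's \<Rightarrow> real ^ 's" where
  "KL_var m \<nu> = (\<chi> y. deriv (KL_coord m \<nu> y) (m $ y))"

definition gauge_space :: "real ^ 's::finite \<Rightarrow> (real ^ 's) set" where
  "gauge_space \<nu> = {g. Expect \<nu> g = 0}"

definition flow_field ::
  "real ^ 's ^ 's::finite \<Rightarrow> real ^ 's \<Rightarrow> real ^ 's \<Rightarrow> real ^ 's \<Rightarrow> real ^ 's" where
  "flow_field K \<mu> \<nu> g =
     - log_ratio (marginal K \<mu> g) \<nu> + Expect \<nu> (log_ratio (marginal K \<mu> g) \<nu>) *\<^sub>R vec 1"

text \<open>The derivative at \<open>t = 0\<close> is the right-hand one.\<close>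

definition is_flow_solution ::
  "real ^ 's ^ 's::finite \<Rightarrow> real ^ 's \<Rightarrow> real ^ 's \<Rightarrow> real ^ 's \<Rightarrow> (real \<Rightarrow> real ^ 's) \<Rightarrow> bool" where
  "is_flow_solution K \<mu> \<nu> g0 g \<longleftrightarrow> g 0 = g0 \<and>
     (\<forall>t\<ge>0. (g has_vector_derivative flow_field K \<mu> \<nu> (g t)) (at t within {0..}))"

end

theory Submission
  imports Defs
begin

text \<open>The Jacobian of \<open>g \<mapsto> marginal K \<mu> g\<close> is \<open>Kop K \<mu> g\<close>, so by the chain rule the marginal
  moves with velocity \<open>Kop K \<mu> (g t) *v flow_field K \<mu> \<nu> (g t)\<close>. The flow field is
  \<open>- log_ratio (m t) \<nu>\<close> plus a multiple of the constant vector, and constants lie in the kernel of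
  the Jacobian, because adding a constant to \<open>g\<close> leaves each tilted distribution unchanged
  (\<open>Kop_vec\<close>). Hence the gauge term drops out. The first variation of the relative entropy differs
  from the log ratio by the constant vector as well (\<open>KL_var_eq\<close>), so the two expressions for the
  velocity agree.\<close>

lemma sum_tilted:
  fixes K :: "real ^ 's ^ 's::finite"
  assumes "\<And>x y. K $ x $ y > 0"
  shows "(\<Sum>y\<in>UNIV. tilted K g x $ y) = 1"
  using Zfun_pos[OF assms, of g x]
  by (simp add: tilted_def flip: sum_divide_distrib Zfun_def)

text \<open>Each summand of \<open>Kop\<close> is a multiple of the covariance matrix
  \<open>Diag p - outer p p\<close> of a probability vector \<open>p\<close>, which sends the constant vector \<open>c\<close> to \<open>p(y) c - p(y) \<Sum>\<^sub>z p(z) c = 0\<close>.\<close>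

lemma Kop_vec:
  fixes K :: "real ^ 's ^ 's::finite"
  assumes K: "\<And>x y. K $ x $ y > 0"
  shows "Kop K \<mu> g *v vec c = 0"
proof -
  have row: "(\<Sum>z\<in>UNIV. Diag (tilted K g x) $ y $ z - outer (tilted K g x) (tilted K g x) $ y $ z) = 0"
    for x y
    by (simp add: Diag_def outer_def sum_subtractf sum_tilted[OF K] flip: sum_distrib_left)
  have "(\<Sum>z\<in>UNIV. Kop K \<mu> g $ y $ z) = 0" for y
  proof -
    have "(\<Sum>z\<in>UNIV. Kop K \<mu> g $ y $ z) =
        (\<Sum>z\<in>UNIV. \<Sum>x\<in>UNIV. \<mu> $ x *
          (Diag (tilted K g x) $ y $ z - outer (tilted K g x) (tilted K g x) $ y $ z))"
      by (simp add: Kop_def)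
    also have "\<dots> = (\<Sum>x\<in>UNIV. \<mu> $ x *
          (\<Sum>z\<in>UNIV. Diag (tilted K g x) $ y $ z - outer (tilted K g x) (tilted K g x) $ y $ z))"
      by (subst sum.swap) (simp only: sum_distrib_left)
    finally show ?thesis by (simp add: row)
  qed
  then show ?thesis
    by (simp add: vec_eq_iff matrix_vector_mult_def flip: sum_distrib_right)
qed

lemma marginal_pos:
  fixes K :: "real ^ 's ^ 's::finite"
  assumes K: "\<And>x y. K $ x $ y > 0" and "\<And>x. \<mu> $ x > 0"
  shows "marginal K \<mu> g $ y > 0"
  unfolding marginal_def
  by (auto simp: tilted_def intro!: sum_pos mult_pos_pos divide_pos_pos assms Zfun_pos[OF K])

text \<open>Only one summand of \<open>KL\<close> depends on the coordinate that varies, and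
  \<open>s \<mapsto> s * ln (s / n)\<close> has derivative \<open>ln (s / n) + 1\<close>.\<close>

lemma KL_coord_has_real_derivative:
  fixes p \<nu> :: "real ^ 's::finite"
  assumes "p $ y > 0" "\<nu> $ y > 0"
  shows "(KL_coord p \<nu> y has_real_derivative ln (p $ y / \<nu> $ y) + 1) (at (p $ y))"
proof -
  have eq: "KL_coord p \<nu> y =
      (\<lambda>s. s * ln (s / \<nu> $ y) + (\<Sum>z\<in>UNIV - {y}. p $ z * ln (p $ z / \<nu> $ z)))"
    by (rule ext) (simp add: KL_coord_def KL_def sum.remove[of UNIV y])
  show ?thesis
    unfolding eq using assms by (auto intro!: derivative_eq_intros simp: field_simps)
qed

lemma KL_var_eq:
  fixes p \<nu> :: "real ^ 's::finite"
  assumes "\<And>y. p $ y > 0" "\<And>y. \<nu> $ y > 0"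
  shows "KL_var p \<nu> = log_ratio p \<nu> + vec 1"
  using DERIV_imp_deriv[OF KL_coord_has_real_derivative[OF assms]]
  by (simp add: vec_eq_iff KL_var_def log_ratio_def)

text \<open>The gauge term of the flow field is a multiple of the constant vector, to which the Jacobian
  is blind by \<open>Kop_vec\<close>.\<close>

lemma Kop_flow_field:
  fixes K :: "real ^ 's ^ 's::finite"
  assumes "\<And>x y. K $ x $ y > 0"
  shows "Kop K \<mu> g *v flow_field K \<mu> \<nu> g = - (Kop K \<mu> g *v log_ratio (marginal K \<mu> g) \<nu>)"
proof -
  have "Kop K \<mu> g *v (- r + c *\<^sub>R vec 1) = - (Kop K \<mu> g *v r)" for r c
    using matrix_vector_mult_diff_distrib[of "Kop K \<mu> g" "c *\<^sub>R vec 1" r]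
    by (simp only: matrix_vector_mult_scaleR Kop_vec[OF assms]) simp
  then show ?thesis
    by (simp only: flow_field_def)
qed

theorem mainTheorem9:
  fixes Q K :: "real ^ 's ^ 's::finite"
    and \<mu> \<nu> g0 :: "real ^ 's"
    and g m :: "real \<Rightarrow> real ^ 's"
  assumes "is_generator Q"
    and "K = matexp Q"
    and "is_prob_vec \<mu>" and "is_prob_vec \<nu>"
    and "\<forall>x y. K $ x $ y > 0"
    and "\<forall>x. \<mu> $ x > 0"
    and "\<forall>y. \<nu> $ y > 0"
    and "g0 \<in> gauge_space \<nu>"
    and "is_flow_solution K \<mu> \<nu> g0 g"
    and "\<forall>t\<ge>0. m t = marginal K \<mu> (g t)"
  shows "(\<forall>t\<ge>0.
            (m has_vector_derivative - (Kop K \<mu> (g t) *v log_ratio (m t) \<nu>)) (at t within {0..})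
          \<and> - (Kop K \<mu> (g t) *v log_ratio (m t) \<nu>) = - (Kop K \<mu> (g t) *v KL_var (m t) \<nu>))
       \<and> (\<forall>p :: real ^ 's. (\<forall>y. p $ y > 0) \<longrightarrow>
            (\<forall>y. KL_coord p \<nu> y differentiable (at (p $ y)))
          \<and> KL_var p \<nu> = log_ratio p \<nu> + vec 1)"
proof -
  have K: "\<And>x y. K $ x $ y > 0" and \<mu>: "\<And>x. \<mu> $ x > 0" and \<nu>: "\<And>y. \<nu> $ y > 0"
    using assms(5-7) by auto
  have var: "KL_var p \<nu> = log_ratio p \<nu> + vec 1" if "\<forall>y. p $ y > 0" for p
    using KL_var_eq \<nu> that by blast
  have diff: "KL_coord p \<nu> y differentiable (at (p $ y))" if "\<forall>y. p $ y > 0" for p y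
    using KL_coord_has_real_derivative[of p y \<nu>] \<nu> that
    by (auto simp: real_differentiable_def)
  have deriv: "(m has_vector_derivative - (Kop K \<mu> (g t) *v log_ratio (m t) \<nu>)) (at t within {0..})"
    if t: "t \<ge> 0" for t
  proof -
    have "(g has_vector_derivative flow_field K \<mu> \<nu> (g t)) (at t within {0..})"
      using assms(9) t by (simp add: is_flow_solution_def)
    then have "((\<lambda>s. marginal K \<mu> (g s)) has_vector_derivative
        Kop K \<mu> (g t) *v flow_field K \<mu> \<nu> (g t)) (at t within {0..})"
      using vector_derivative_diff_chain_within[OF _ has_derivative_at_withinI[OF has_derivative_marginal[OF K]]]
      by (auto simp: o_def)
    then show ?thesis
      using t assms(10)
      by (auto simp: Kop_flow_field[OF K] intro: has_vector_derivative_transform)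
  qed
  have "Kop K \<mu> (g t) *v log_ratio (m t) \<nu> = Kop K \<mu> (g t) *v KL_var (m t) \<nu>" if "t \<ge> 0" for t
    using assms(10) that marginal_pos[OF K \<mu>]
    by (simp add: var matrix_vector_right_distrib Kop_vec[OF K, where c = 1, simplified])
  then show ?thesis
    using deriv var diff by auto
qed

end
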